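(* Let $Q=(Q,\bigvee,\circ,1)$ be a quantale, let $\mathbb{C}$ be a symmetric $Q$-category (meaning that $\mathbb{C}(x,y)=\mathbb{C}(y,x)$ for all $x,y\in\mathbb{C}_0$), and let $f:\mathbb{C}\to\mathbb{C}$ be any $\varphi$-contraction (for some control function $\varphi:Q\to Q$). If $u,u'\in\mathbb{C}_0$ satisfy $fu\cong u$ and $fu'\cong u'$, then either $u\cong u'$ or $\mathbb{C}(u,u')=0$.
   Context: A quantale $Q=(Q,\bigvee,\circ,1)$ is a complete lattice with a monoid structure $(Q,\circ,1)$ such that $\circ$ distributes over arbitrary suprema in each variable; $1$ need not be the top element and $\circ$ need not be commutative; $0$ denotes the bottom element. A $Q$-category $\mathbb{C}$ is a set $\mathbb{C}_0$ with a map $\mathbb{C}_0\times\mathbb{C}_0\to Q$, $(x,y)\mapsto\mathbb{C}(x,y)$, such that $\mathbb{C}(x,y)\circ\mathbb{C}(y,z)\le\mathbb{C}(x,z)$ and $1\le\mathbb{C}(x,x)$ for all $x,y,z$. Objects $c,c'$ are isomorphic, $c\cong c'$, if $1\le\mathbb{C}(c,c')$ and $1\le\mathbb{C}(c',c)$. Given maps $\varphi:Q\to Q$ and $f:\mathbb{C}_0\to\mathbb{C}_0$, $f$ is a $\varphi$-contraction, and $\varphi$ is a control function for $f$, if: (1) $\varphi(t)\ge t$ for all $t\in Q$; (2) if $\varphi(t)=t$ then $t=0$ or $1\le t$; (3) $\mathbb{C}(fx,fy)\ge\varphi(\mathbb{C}(x,y))$ for all $x,y\in\mathbb{C}_0$.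 *)

theory Defs
  imports Main "HOL-Library.FuncSet"
begin

(* The multiplication need not be commutative, and 1 need not be the top element.
   The bottom element of the quantale is written bot (the class has no symbol 0). The two
   distributivity laws include the case A = {}, so bot is absorbing. *)
class quantale = complete_lattice + monoid_mult +
  assumes Sup_mult_distrib: "Sup A * b = (SUP a\<in>A. a * b)"
    and mult_Sup_distrib: "a * Sup B = (SUP b\<in>B. a * b)"

locale quantale_category =
  fixes Ob :: "'o set" and hom :: "'o \<Rightarrow> 'o \<Rightarrow> 'q::quantale"
  assumes hom_comp: "\<lbrakk>x \<in> Ob; y \<in> Ob; z \<in> Ob\<rbrakk> \<Longrightarrow> hom x y * hom y z \<le> hom x z"
    and hom_refl: "x \<in> Ob \<Longrightarrow> 1 \<le> hom x x"

locale symmetric_quantale_category = quantale_category +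
  assumes hom_sym: "\<lbrakk>x \<in> Ob; y \<in> Ob\<rbrakk> \<Longrightarrow> hom x y = hom y x"

(* Only meant for objects c, c' of the category; membership is assumed where it is used. *)
definition obj_iso :: "('o \<Rightarrow> 'o \<Rightarrow> 'q::quantale) \<Rightarrow> 'o \<Rightarrow> 'o \<Rightarrow> bool" where
  "obj_iso hom c c' \<longleftrightarrow> 1 \<le> hom c c' \<and> 1 \<le> hom c' c"

definition phi_contraction ::
  "'o set \<Rightarrow> ('o \<Rightarrow> 'o \<Rightarrow> 'q::quantale) \<Rightarrow> ('q \<Rightarrow> 'q) \<Rightarrow> ('o \<Rightarrow> 'o) \<Rightarrow> bool" where
  "phi_contraction Ob hom \<phi> f \<longleftrightarrow>
     f \<in> Ob \<rightarrow> Ob \<and>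
     (\<forall>t. t \<le> \<phi> t) \<and>
     (\<forall>t. \<phi> t = t \<longrightarrow> t = bot \<or> 1 \<le> t) \<and>
     (\<forall>x\<in>Ob. \<forall>y\<in>Ob. \<phi> (hom x y) \<le> hom (f x) (f y))"

end

theory Submission
  imports Defs
begin

text \<open>
  Homs into and out of isomorphic objects agree, so for fixed points \<open>u\<close>, \<open>u'\<close> up to isomorphism
  the contraction condition closes into a cycle
  \<open>hom u u' \<le> \<phi> (hom u u') \<le> hom (f u) (f u') \<le> hom u u'\<close>.
  Hence \<open>hom u u'\<close> is a fixed point of \<open>\<phi>\<close>, and the control function only has fixed points that
  are bottom or lie above the unit. In the latter case symmetry supplies the second half of the
  isomorphism.
\<close>

text \<open>The order is recovered from binary suprema, so distributivity forces monotonicity.\<close>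

lemma quantale_mult_left_mono:
  fixes a b c :: "'q::quantale"
  assumes "b \<le> c"
  shows "a * b \<le> a * c"
proof -
  have "a * Sup {b, c} = sup (a * b) (a * c)"
    unfolding mult_Sup_distrib by simp
  with assms show ?thesis
    by (simp add: sup.absorb2 le_iff_sup)
qed

lemma quantale_mult_right_mono:
  fixes a b c :: "'q::quantale"
  assumes "a \<le> b"
  shows "a * c \<le> b * c"
proof -
  have "Sup {a, b} * c = sup (a * c) (b * c)"
    unfolding Sup_mult_distrib by simp
  with assms show ?thesis
    by (simp add: sup.absorb2 le_iff_sup)
qed

text \<open>Multiplying by an element above the unit is inflationary, so composition transports homs along
  one direction of an isomorphism at each end.\<close>

lemma (in quantale_category) hom_le_of_units:
  assumes "x \<in> Ob" "x' \<in> Ob" "y \<in> Ob" "y' \<in> Ob"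
    and "1 \<le> hom x' x" and "1 \<le> hom y y'"
  shows "hom x y \<le> hom x' y'"
proof -
  have "hom x y \<le> hom x' x * hom x y"
    using quantale_mult_right_mono[OF assms(5)] by simp
  also have "\<dots> \<le> hom x' y"
    using assms by (intro hom_comp)
  also have "\<dots> \<le> hom x' y * hom y y'"
    using quantale_mult_left_mono[OF assms(6)] by simp
  also have "\<dots> \<le> hom x' y'"
    using assms by (intro hom_comp)
  finally show ?thesis .
qed

theorem proposition2p1p4:
  fixes Ob :: "'o set"
    and hom :: "'o \<Rightarrow> 'o \<Rightarrow> 'q::quantale"
    and \<phi> :: "'q \<Rightarrow> 'q"
    and f :: "'o \<Rightarrow> 'o"
    and u u' :: 'o
  assumes "symmetric_quantale_category Ob hom"
    and "phi_contraction Ob hom \<phi> f"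
    and "u \<in> Ob" and "u' \<in> Ob"
    and "obj_iso hom (f u) u" and "obj_iso hom (f u') u'"
  shows "obj_iso hom u u' \<or> hom u u' = bot"
proof -
  interpret symmetric_quantale_category Ob hom by fact
  have f_Ob: "f u \<in> Ob" "f u' \<in> Ob"
    and expand: "hom u u' \<le> \<phi> (hom u u')"
    and fixed: "\<phi> (hom u u') = hom u u' \<Longrightarrow> hom u u' = bot \<or> 1 \<le> hom u u'"
    and contract: "\<phi> (hom u u') \<le> hom (f u) (f u')"
    using assms(2-4) unfolding phi_contraction_def by auto
  have "hom (f u) (f u') \<le> hom u u'"
    using hom_le_of_units f_Ob assms(3-6) unfolding obj_iso_def by blast
  with contract expand have "\<phi> (hom u u') = hom u u'"
    by (meson order.antisym order.trans)
  with fixed have "hom u u' = bot \<or> 1 \<le> hom u u'"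
    by blast
  then show ?thesis
    using hom_sym[OF assms(3,4)] unfolding obj_iso_def by auto
qed

end
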